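(* The class $\mathcal{C}_{Ne}$ satisfies the following properties: (a) $\mathcal{C}_{Ne}\subset\mathcal{C}(\alpha)$ whenever $0\leq\alpha\leq1-\frac{2\sqrt{2}}{3}$. (b) $\mathcal{C}_{Ne}\subset\mathcal{SC}(\beta)$ whenever $\beta_0\leq\beta\leq1$, where $\beta_0=\frac{2}{\pi}\arctan(4\sqrt5)\approx0.929121$. (c) $\mathcal{C}(q_c)\subset\mathcal{C}_{Ne}$ whenever $0<c\leq\frac{8}{9}$. (d) $k\text{-}UCV\subset\mathcal{C}_{Ne}$ whenever $k\geq\frac{5}{2}$. (e) $\mathcal{C}_{\alpha,e}\subset\mathcal{C}_{Ne}$ whenever $1-\frac{2/3}{e-1}\leq\alpha<1$. (f) $\mathcal{CL}(\alpha)\subset\mathcal{C}_{Ne}$ whenever $\frac{1}{3}\leq\alpha<1$. The constant in each part is best possible: the constants $1-\frac{2\sqrt2}{3}$ in (a) and $\frac89$ in (c) cannot be replaced by larger ones, and the constants $\beta_0$ in (b), $\frac52$ in (d), $1-\frac{2/3}{e-1}$ in (e) and $\frac13$ in (f) cannot be replaced by smaller ones.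
   Context: $\mathbb{D}$ is the open unit disk. $\mathcal{A}$ is the set of analytic functions $f$ on $\mathbb{D}$ with $f(0)=0$ and $f'(0)=1$. For analytic $f,g$ on $\mathbb{D}$, $f\prec g$ means there is an analytic $w$ on $\mathbb{D}$ with $w(0)=0$, $|w(z)|<1$ and $f(z)=g(w(z))$ on $\mathbb{D}$. For analytic $\varphi$ on $\mathbb{D}$ with $\varphi(0)=1$, $\mathcal{C}(\varphi)=\{f\in\mathcal{A}: 1+zf''(z)/f'(z)\prec\varphi(z)\}$. Definitions of the classes: $\mathcal{C}_{Ne}=\mathcal{C}(1+z-z^3/3)$; $\mathcal{C}(\alpha)=\{f\in\mathcal{A}:\mathrm{Re}(1+zf''(z)/f'(z))>\alpha \text{ on } \mathbb{D}\}$ for $0\le\alpha<1$; $\mathcal{SC}(\beta)=\{f\in\mathcal{A}:|\arg(1+zf''(z)/f'(z))|<\beta\pi/2 \text{ on } \mathbb{D}\}$ for $0<\beta\le1$; $\mathcal{C}(q_c)$ with $q_c(z)=\sqrt{1+cz}$, $0<c\le1$; $k\text{-}UCV$ ($k\ge0$), the $k$-uniformly convex functions: $f\in\mathcal{A}$ such that $1+zf''(z)/f'(z)$ is analytic on $\mathbb{D}$ with values in the conic region $\{w\in\mathbb{C}:\mathrm{Re}\,w>k|w-1|\}$; $\mathcal{C}_{\alpha,e}=\mathcal{C}(\alpha+(1-\alpha)e^z)$ and $\mathcal{CL}(\alpha)=\mathcal{C}(\alpha+(1-\alpha)\sqrt{1+z})$ for $0\le\alpha<1$. Principal branches of square roots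 and of $\arg$ are used. *)

theory Defs
  imports "HOL-Complex_Analysis.Complex_Analysis"
begin

abbreviation unit_disk :: "complex set" where
  "unit_disk \<equiv> ball 0 1"

text \<open>The functions are total HOL functions of which only the values on the unit disk matter:
  every class below depends only on the restriction of its members to the disk.\<close>

definition class_A :: "(complex \<Rightarrow> complex) set" where
  "class_A = {f. f holomorphic_on unit_disk \<and> f 0 = 0 \<and> deriv f 0 = 1}"

definition subordinate :: "(complex \<Rightarrow> complex) \<Rightarrow> (complex \<Rightarrow> complex) \<Rightarrow> bool"
    (infix \<open>\<prec>\<close> 50) where
  "f \<prec> g \<longleftrightarrow> f holomorphic_on unit_disk \<and> g holomorphic_on unit_disk \<and>
     (\<exists>w. w holomorphic_on unit_disk \<and> w 0 = 0 \<and>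
          (\<forall>z\<in>unit_disk. norm (w z) < 1) \<and> (\<forall>z\<in>unit_disk. f z = g (w z)))"

definition convexity_quotient :: "(complex \<Rightarrow> complex) \<Rightarrow> complex \<Rightarrow> complex" where
  "convexity_quotient f z = 1 + z * deriv (deriv f) z / deriv f z"

text \<open>Since division by zero is total in HOL, the requirement that \<open>1 + z f''(z) / f'(z)\<close> is
  defined on the whole disk, implicit in each of the classes, is made explicit here.\<close>

definition class_A_reg :: "(complex \<Rightarrow> complex) set" where
  "class_A_reg = {f \<in> class_A. \<forall>z\<in>unit_disk. deriv f z \<noteq> 0}"

definition class_C :: "(complex \<Rightarrow> complex) \<Rightarrow> (complex \<Rightarrow> complex) set" where
  "class_C \<phi> = {f \<in> class_A_reg. convexity_quotient f \<prec> \<phi>}"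

definition class_C_Ne :: "(complex \<Rightarrow> complex) set" where
  "class_C_Ne = class_C (\<lambda>z. 1 + z - z ^ 3 / 3)"

definition class_C_order :: "real \<Rightarrow> (complex \<Rightarrow> complex) set" where
  "class_C_order \<alpha> = {f \<in> class_A_reg. \<forall>z\<in>unit_disk. Re (convexity_quotient f z) > \<alpha>}"

text \<open>The argument of \<open>0\<close> is undefined, whereas \<open>Arg 0 = 0\<close> in the library; hence the
  condition that the quotient does not vanish.\<close>

definition class_SC :: "real \<Rightarrow> (complex \<Rightarrow> complex) set" where
  "class_SC \<beta> = {f \<in> class_A_reg. \<forall>z\<in>unit_disk. convexity_quotient f z \<noteq> 0 \<and>
     \<bar>Arg (convexity_quotient f z)\<bar> < \<beta> * pi / 2}"

definition class_C_q :: "real \<Rightarrow> (complex \<Rightarrow> complex) set" where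
  "class_C_q c = class_C (\<lambda>z. csqrt (1 + of_real c * z))"

definition class_UCV :: "real \<Rightarrow> (complex \<Rightarrow> complex) set" where
  "class_UCV k = {f \<in> class_A_reg. convexity_quotient f holomorphic_on unit_disk \<and>
     (\<forall>z\<in>unit_disk. convexity_quotient f z \<in> {w. Re w > k * norm (w - 1)})}"

definition class_C_exp :: "real \<Rightarrow> (complex \<Rightarrow> complex) set" where
  "class_C_exp \<alpha> = class_C (\<lambda>z. of_real \<alpha> + (1 - of_real \<alpha>) * exp z)"

definition class_CL :: "real \<Rightarrow> (complex \<Rightarrow> complex) set" where
  "class_CL \<alpha> = class_C (\<lambda>z. of_real \<alpha> + (1 - of_real \<alpha>) * csqrt (1 + z))"

definition beta0 :: real where
  "beta0 = 2 / pi * arctan (4 * sqrt 5)"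

end

theory Submission
  imports Defs
begin

text \<open>Write \<open>\<phi>(z) = 1 + z - z\<^sup>3 / 3\<close>. On the circle \<open>\<phi>\<close> satisfies the two half-plane inequalities behind
  (a) and (b), with equality at \<open>Re z = - 1 / \<surd>2\<close> and \<open>Re z = - 2 / 3\<close>; the maximum principle and the
  open mapping theorem turn them into strict inequalities inside.

  The univalent function \<open>\<phi>\<close> covers the disk of radius \<open>2 / 3\<close> about \<open>1\<close>, and its real values in the
  unit disk lie in that disk. In each of (c)-(f) the constant is exactly the one for which the
  convexity quotient stays within distance \<open>2 / 3\<close> of \<open>1\<close>; beyond it the quotient attains a real value
  at distance at least \<open>2 / 3\<close> from \<open>1\<close>, so the inclusion fails. Any holomorphic \<open>p\<close> with \<open>p(0) = 1\<close> is
  a convexity quotient, by integrating \<open>f'' / f' = (p - 1) / z\<close> twice.\<close>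

subsection \<open>The nephroid function\<close>

definition neph :: "complex \<Rightarrow> complex" where
  "neph z = 1 + z - z ^ 3 / 3"

lemma class_C_Ne_eq: "class_C_Ne = class_C neph"
  by (simp add: class_C_Ne_def neph_def[abs_def])

lemma neph_holomorphic_on [holomorphic_intros]: "neph holomorphic_on A"
  unfolding neph_def[abs_def] by (intro holomorphic_intros) auto

lemma isCont_neph: "isCont neph z"
  unfolding neph_def[abs_def] by (intro continuous_intros) auto

lemma Re_neph: "Re (neph z) = 1 + Re z - Re z ^ 3 / 3 + Re z * Im z ^ 2"
  and Im_neph: "Im (neph z) = Im z * (1 - Re z ^ 2 + Im z ^ 2 / 3)"
  by (simp_all add: neph_def power3_eq_cube power2_eq_square field_simps)

text \<open>The difference of two values is \<open>z - w\<close> times a factor that could vanish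
  only if three numbers of modulus less than 1 added up to 3.\<close>

lemma neph_inj_on: "inj_on neph unit_disk"
proof (rule inj_onI)
  fix z w :: complex
  assume zw: "z \<in> unit_disk" "w \<in> unit_disk" and eq: "neph z = neph w"
  have "(z - w) * (3 - (z\<^sup>2 + z * w + w\<^sup>2)) = 3 * (neph z - neph w)"
    by (simp add: neph_def power3_eq_cube power2_eq_square algebra_simps)
  with eq have 0: "(z - w) * (3 - (z\<^sup>2 + z * w + w\<^sup>2)) = 0"
    by simp
  have "norm (z\<^sup>2) < 1" "norm (z * w) < 1" "norm (w\<^sup>2) < 1"
    using zw mult_strict_mono'[of "norm z" 1 "norm w" 1]
    by (auto simp: norm_power norm_mult power_less_one_iff abs_square_less_1)
  then have "norm (z\<^sup>2 + z * w + w\<^sup>2) < 3"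
    using norm_triangle_ineq[of "z\<^sup>2 + z * w" "w\<^sup>2"] norm_triangle_ineq[of "z\<^sup>2" "z * w"]
    by linarith
  then have "3 - (z\<^sup>2 + z * w + w\<^sup>2) \<noteq> 0"
    by auto
  with 0 show "z = w"
    by simp
qed

section \<open>Boundary curve and half-plane bounds\<close>

lemma neph_on_circle:
  assumes "norm z = 1"
  shows "Re (neph z) = 1 + 2 * Re z - 4 / 3 * Re z ^ 3" and "Im (neph z) = 4 / 3 * Im z ^ 3"
proof -
  have "(Re z)\<^sup>2 + (Im z)\<^sup>2 = 1"
    using assms by (simp add: cmod_def)
  then have y: "(Im z)\<^sup>2 = 1 - (Re z)\<^sup>2" and x: "(Re z)\<^sup>2 = 1 - (Im z)\<^sup>2"
    by auto
  show "Re (neph z) = 1 + 2 * Re z - 4 / 3 * Re z ^ 3"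
    unfolding Re_neph y by (simp add: power3_eq_cube power2_eq_square algebra_simps)
  show "Im (neph z) = 4 / 3 * Im z ^ 3"
    unfolding Im_neph x by (simp add: power3_eq_cube power2_eq_square algebra_simps)
qed

text \<open>The maximum principle for \<open>cnj a * neph\<close>, whose real part is the inner
  product, carries the bound into the disk. The image under the injective holomorphic
  \<open>neph\<close> is open, so it lies in the interior of the closed half-plane; this gives
  strictness.\<close>

lemma neph_halfspace:
  assumes circle: "\<And>z. norm z = 1 \<Longrightarrow> a \<bullet> neph z \<le> b" and "a \<noteq> 0" and z: "z \<in> unit_disk"
  shows "a \<bullet> neph z < b"
proof -
  have inner: "Re (cnj a * v) = a \<bullet> v" for v
    by (simp add: inner_complex_def)
  have le: "a \<bullet> neph w \<le> b" if "w \<in> unit_disk" for w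
  proof -
    have "Re (cnj a * neph w) \<le> b"
    proof (rule maximum_real_frontier[where S = unit_disk and f = "\<lambda>w. cnj a * neph w"])
      show "continuous_on (closure unit_disk) (\<lambda>w. cnj a * neph w)"
        by (intro holomorphic_on_imp_continuous_on holomorphic_intros)
      show "Re (cnj a * neph v) \<le> b" if "v \<in> frontier unit_disk" for v
        using circle[of v] that inner[of "neph v"] by simp
    qed (use that in \<open>auto intro!: holomorphic_intros\<close>)
    then show ?thesis
      unfolding inner .
  qed
  have "open (neph ` unit_disk)"
    by (intro open_mapping_thm3 neph_inj_on holomorphic_intros) auto
  moreover have "neph ` unit_disk \<subseteq> {v. a \<bullet> v \<le> b}"
    using le by auto
  ultimately have "neph ` unit_disk \<subseteq> interior {v. a \<bullet> v \<le> b}"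
    by (rule interior_maximal[rotated])
  then have "neph z \<in> {v. a \<bullet> v < b}"
    using z \<open>a \<noteq> 0\<close> by (metis image_subset_iff interior_halfspace_le)
  then show ?thesis
    by simp
qed

lemma neph_circle_Re_ge:
  assumes "norm z = 1"
  shows "Re (neph z) \<ge> 1 - 2 * sqrt 2 / 3"
proof -
  have x: "Re z \<le> 1"
    using complex_Re_le_cmod[of z] assms by simp
  define s where "s = sqrt 2"
  have s: "s * s = 2" "s > 1"
    by (auto simp: s_def)
  have "s * s * s = 2 * s"
    using s by simp
  \<comment> \<open>The cubic in \<open>Re z\<close> has a double root at \<open>- s / 2\<close>,
    where the bound is attained, and its third root \<open>s\<close> exceeds 1.\<close>
  then have "3 * (Re (neph z) - (1 - 2 * s / 3)) = 4 * (Re z + s / 2)\<^sup>2 * (s - Re z)"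
    using s unfolding neph_on_circle[OF assms]
    by (simp add: power3_eq_cube power2_eq_square field_simps)
  moreover have "4 * (Re z + s / 2)\<^sup>2 * (s - Re z) \<ge> 0"
    using s x by (intro mult_nonneg_nonneg) auto
  ultimately have "3 * (Re (neph z) - (1 - 2 * s / 3)) \<ge> 0"
    by metis
  then show ?thesis
    by (simp add: s_def)
qed

lemma neph_Re_gt:
  assumes "z \<in> unit_disk"
  shows "Re (neph z) > 1 - 2 * sqrt 2 / 3"
proof -
  have "(-1) \<bullet> neph z < - (1 - 2 * sqrt 2 / 3)"
  proof (rule neph_halfspace)
    show "(-1) \<bullet> neph w \<le> - (1 - 2 * sqrt 2 / 3)" if "norm w = 1" for w
      using neph_circle_Re_ge[OF that] by (simp add: inner_complex_def)
  qed (use assms in auto)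
  then show ?thesis
    by (simp add: inner_complex_def)
qed

lemma two_sqrt2_less_3: "2 * sqrt 2 < (3 :: real)"
  by (rule power2_less_imp_less) (auto simp: power_mult_distrib)

lemma neph_Re_pos: "z \<in> unit_disk \<Longrightarrow> Re (neph z) > 0"
  using neph_Re_gt[of z] two_sqrt2_less_3 by simp

lemma neph_circle_sector:
  assumes "norm z = 1"
  shows "\<bar>Im (neph z)\<bar> \<le> 4 * sqrt 5 * Re (neph z)"
proof (rule power2_le_imp_le)
  define c where "c = Re z"
  have "c\<^sup>2 + (Im z)\<^sup>2 = 1"
    using assms by (simp add: cmod_def c_def)
  then have y: "(Im z)\<^sup>2 = 1 - c\<^sup>2" and "c\<^sup>2 \<le> 1"
    using zero_le_power2[of "Im z"] by linarith+
  \<comment> \<open>Up to a positive factor this is the difference of the two sides of the squared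
    claim. The double root \<open>c = - 2 / 3\<close> is the point of equality; the cofactor is
    positive since \<open>c\<^sup>2 \<le> 1\<close>.\<close>
  then have "(3 * c + 2)\<^sup>2 * ((3 * c\<^sup>2 - 2 * c - 3)\<^sup>2 + (2 - c\<^sup>2)) \<ge> 0"
    by (intro mult_nonneg_nonneg add_nonneg_nonneg) auto
  also have "(3 * c + 2)\<^sup>2 * ((3 * c\<^sup>2 - 2 * c - 3)\<^sup>2 + (2 - c\<^sup>2))
      = 5 * (3 + 6 * c - 4 * c ^ 3)\<^sup>2 - (1 - c\<^sup>2) ^ 3"
    by algebra
  finally have *: "(1 - c\<^sup>2) ^ 3 \<le> 5 * (3 + 6 * c - 4 * c ^ 3)\<^sup>2"
    by simp
  have "\<bar>Im (neph z)\<bar>\<^sup>2 = 16 / 9 * ((Im z)\<^sup>2) ^ 3"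
    unfolding neph_on_circle[OF assms] power2_abs by algebra
  also have "\<dots> \<le> 16 / 9 * (5 * (3 + 6 * c - 4 * c ^ 3)\<^sup>2)"
    using * by (simp add: y)
  also have "3 + 6 * c - 4 * c ^ 3 = 3 * Re (neph z)"
    unfolding neph_on_circle[OF assms] by (simp add: c_def)
  also have "16 / 9 * (5 * (3 * Re (neph z))\<^sup>2) = (4 * sqrt 5 * Re (neph z))\<^sup>2"
    by (simp add: power_mult_distrib)
  finally show "\<bar>Im (neph z)\<bar>\<^sup>2 \<le> (4 * sqrt 5 * Re (neph z))\<^sup>2" .
  show "0 \<le> 4 * sqrt 5 * Re (neph z)"
    using neph_circle_Re_ge[OF assms] two_sqrt2_less_3 by (intro mult_nonneg_nonneg) auto
qed

text \<open>The sector is the intersection of two half-planes, with normals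
  \<open>Complex (- (4 * sqrt 5)) t\<close> for t = 1 and t = -1.\<close>

lemma neph_sector:
  assumes "z \<in> unit_disk"
  shows "\<bar>Im (neph z)\<bar> < 4 * sqrt 5 * Re (neph z)"
proof -
  have "Complex (- (4 * sqrt 5)) t \<bullet> neph z < 0" if "\<bar>t\<bar> = 1" for t
  proof (rule neph_halfspace)
    show "Complex (- (4 * sqrt 5)) t \<bullet> neph w \<le> 0" if "norm w = 1" for w
      using neph_circle_sector[OF that] \<open>\<bar>t\<bar> = 1\<close>
      by (auto simp: inner_complex_def abs_if split: if_splits)
  qed (use assms that in \<open>auto simp: complex_eq_iff\<close>)
  from this[of 1] this[of "-1"] show ?thesis
    by (simp add: inner_complex_def abs_less_iff)
qed

section \<open>Real values of \<open>neph\<close> and the disk that its image covers\<close>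

lemma neph_real_value:
  assumes "z \<in> unit_disk" "Im (neph z) = 0"
  shows "\<bar>Re (neph z) - 1\<bar> < 2 / 3"
proof -
  have "\<bar>Re z\<bar> < 1"
    using abs_Re_le_cmod[of z] assms by simp
  then have "(Re z)\<^sup>2 < 1"
    by (simp add: abs_square_less_1)
  \<comment> \<open>Positivity of this cofactor of \<open>Im z\<close> means that
    \<open>neph\<close> is real only at real points.\<close>
  then have "1 - (Re z)\<^sup>2 + (Im z)\<^sup>2 / 3 > 0"
    using zero_le_power2[of "Im z"] by linarith
  with assms(2) have "Im z = 0"
    by (simp add: Im_neph)
  moreover have "x - x ^ 3 / 3 < 2 / 3" if "\<bar>x\<bar> < 1" for x :: real
  proof -
    \<comment> \<open>The product equals \<open>2 - 3 * x + x ^ 3\<close>, three times the gap in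
      the claim.\<close>
    have "(1 - x)\<^sup>2 * (x + 2) > 0"
      using that by (intro mult_pos_pos) auto
    then show ?thesis
      by (simp add: power2_eq_square power3_eq_cube algebra_simps)
  qed
  from this[of "Re z"] this[of "- Re z"] have "\<bar>Re z - Re z ^ 3 / 3\<bar> < 2 / 3"
    using \<open>\<bar>Re z\<bar> < 1\<close> unfolding abs_less_iff by simp
  ultimately show ?thesis
    by (simp add: Re_neph)
qed

text \<open>A preimage of \<open>\<zeta>\<close> is a fixed point of \<open>z \<mapsto> \<zeta> - 1 + z\<^sup>3 / 3\<close>.\<close>

lemma ball_subset_neph_image: "ball 1 (2 / 3) \<subseteq> neph ` unit_disk"
proof
  fix \<zeta> :: complex
  assume "\<zeta> \<in> ball 1 (2 / 3)"
  then have \<zeta>: "norm (\<zeta> - 1) < 2 / 3"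
    by (simp add: dist_norm norm_minus_commute)
  define T where "T = (\<lambda>z. \<zeta> - 1 + z ^ 3 / 3)"
  have T: "norm (T z) < 1" if "norm z \<le> 1" for z
  proof -
    have "norm (T z) \<le> norm (\<zeta> - 1) + norm (z ^ 3 / 3)"
      unfolding T_def by (rule norm_triangle_ineq)
    moreover have "norm (z ^ 3 / 3) \<le> 1 / 3"
      using that by (simp add: norm_divide norm_power power_le_one)
    ultimately show ?thesis
      using \<zeta> by linarith
  qed
  have "continuous_on (cball 0 1) T"
    unfolding T_def by (intro continuous_intros) auto
  then obtain z where z: "norm z \<le> 1" "T z = z"
    using brouwer[of "cball 0 1" T] T by (force simp: less_imp_le)
  \<comment> \<open>\<open>T\<close> sends the closed disk into the open one, so its fixed point is
    interior.\<close>
  then have "norm z < 1" "neph z = \<zeta>"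
    using T[of z] by (auto simp: T_def neph_def algebra_simps)
  then show "\<zeta> \<in> neph ` unit_disk"
    by force
qed

subsection \<open>Subordination and convexity quotients\<close>

text \<open>Compose \<open>p\<close> with the inverse of the univalent \<open>neph\<close>: the
  bound keeps the values of \<open>p\<close> in the disk about 1 that \<open>neph\<close> covers,
  and \<open>p 0 = 1 = neph 0\<close> gives the normalisation at 0.\<close>

lemma subordinate_nephI:
  assumes p: "p holomorphic_on unit_disk" "p 0 = 1"
    and bound: "\<And>z. z \<in> unit_disk \<Longrightarrow> norm (p z - 1) < 2 / 3"
  shows "p \<prec> neph"
proof -
  obtain g where g: "g holomorphic_on neph ` unit_disk" "\<And>z. z \<in> unit_disk \<Longrightarrow> g (neph z) = z"
    using holomorphic_has_inverse[OF neph_holomorphic_on open_ball neph_inj_on] by metis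
  have im: "p z \<in> neph ` unit_disk" if "z \<in> unit_disk" for z
  proof (rule subsetD[OF ball_subset_neph_image])
    show "p z \<in> ball 1 (2 / 3)"
      using bound[OF that] by (simp add: dist_norm norm_minus_commute)
  qed
  have "(g \<circ> p) holomorphic_on unit_disk"
    by (intro holomorphic_on_compose_gen[OF p(1) g(1)]) (use im in blast)
  moreover have "(g \<circ> p) 0 = 0"
    using g(2)[of 0] p(2) by (simp add: neph_def)
  moreover have "norm ((g \<circ> p) z) < 1 \<and> p z = neph ((g \<circ> p) z)" if "z \<in> unit_disk" for z
  proof -
    from im[OF that] obtain w where "w \<in> unit_disk" "p z = neph w"
      by blast
    then show ?thesis
      using g(2)[of w] by simp
  qed
  ultimately show ?thesis
    unfolding subordinate_def using p(1) neph_holomorphic_on by blast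
qed

lemma convexity_quotient_0 [simp]: "convexity_quotient f 0 = 1"
  by (simp add: convexity_quotient_def)

text \<open>Subordination makes every value of the quotient a value of \<open>\<phi>\<close> on the
  disk, so a bound on \<open>\<phi>\<close> suffices. This reduces (c), (e) and (f) to norm
  estimates.\<close>

lemma class_C_subset_class_C_NeI:
  assumes "\<And>z. z \<in> unit_disk \<Longrightarrow> norm (\<phi> z - 1) < 2 / 3"
  shows "class_C \<phi> \<subseteq> class_C_Ne"
proof
  fix f
  assume "f \<in> class_C \<phi>"
  then obtain w where f: "f \<in> class_A_reg" "convexity_quotient f holomorphic_on unit_disk"
    and "\<forall>z\<in>unit_disk. norm (w z) < 1 \<and> convexity_quotient f z = \<phi> (w z)"
    unfolding class_C_def subordinate_def by blast
  then have "norm (convexity_quotient f z - 1) < 2 / 3" if "z \<in> unit_disk" for z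
    using assms[of "w z"] that by auto
  with f show "f \<in> class_C_Ne"
    using subordinate_nephI[of "convexity_quotient f"] by (simp add: class_C_Ne_eq class_C_def)
qed

lemma class_C_convexity_quotient_values:
  assumes "f \<in> class_C \<phi>" "z \<in> unit_disk"
  obtains w where "w \<in> unit_disk" "convexity_quotient f z = \<phi> w"
proof -
  from assms(1) obtain w where "\<forall>z\<in>unit_disk. norm (w z) < 1"
    "\<forall>z\<in>unit_disk. convexity_quotient f z = \<phi> (w z)"
    unfolding class_C_def subordinate_def by auto
  then show ?thesis
    using that[of "w z"] assms(2) by auto
qed

section \<open>Functions with a prescribed convexity quotient\<close>

lemma ex_convexity_quotient:
  assumes p: "p holomorphic_on unit_disk" "p 0 = 1"
  obtains f where "f \<in> class_A_reg" "\<And>z. z \<in> unit_disk \<Longrightarrow> convexity_quotient f z = p z"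
proof -
  \<comment> \<open>This is \<open>(p z - 1) / z\<close> with its removable singularity filled in,
    in the difference-quotient form of \<open>pole_lemma\<close>.\<close>
  define h where "h = (\<lambda>z. if z = 0 then deriv (\<lambda>z. p z - 1) 0 else ((p z - 1) - (p 0 - 1)) / (z - 0))"
  have "h holomorphic_on unit_disk"
    unfolding h_def
  proof (rule pole_lemma)
    show "(\<lambda>z. p z - 1) holomorphic_on unit_disk"
      by (intro holomorphic_intros p)
  qed simp
  then obtain G where G: "\<And>z. z \<in> unit_disk \<Longrightarrow> (G has_field_derivative h z) (at z within unit_disk)"
    by (rule holomorphic_convex_primitive'[OF convex_ball open_ball]) blast
  \<comment> \<open>\<open>e\<close> will be the derivative of \<open>f\<close>: the exponential
    keeps it free of zeros, and subtracting \<open>G 0\<close> gives it the value 1 at 0.\<close>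
  define e where "e = (\<lambda>z. exp (G z - G 0))"
  have e: "(e has_field_derivative h z * e z) (at z)" if "z \<in> unit_disk" for z
  proof -
    have "(G has_field_derivative h z) (at z)"
      using G[OF that] by (simp only: at_within_open[OF that open_ball])
    then show ?thesis
      unfolding e_def by (auto intro!: derivative_eq_intros)
  qed
  then have "e holomorphic_on unit_disk"
    unfolding holomorphic_on_open[OF open_ball] by blast
  then obtain F where F: "\<And>z. z \<in> unit_disk \<Longrightarrow> (F has_field_derivative e z) (at z within unit_disk)"
    by (rule holomorphic_convex_primitive'[OF convex_ball open_ball]) blast
  define f where "f = (\<lambda>z. F z - F 0)"
  have f: "(f has_field_derivative e z) (at z)" if "z \<in> unit_disk" for z
  proof -
    have "(F has_field_derivative e z) (at z)"
      using F[OF that] by (simp only: at_within_open[OF that open_ball])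
    then show ?thesis
      unfolding f_def by (auto intro!: derivative_eq_intros)
  qed
  have d1: "deriv f z = e z" if "z \<in> unit_disk" for z
    using f[OF that] by (rule DERIV_imp_deriv)
  have d2: "deriv (deriv f) z = h z * e z" if "z \<in> unit_disk" for z
  proof (rule DERIV_imp_deriv)
    show "(deriv f has_field_derivative h z * e z) (at z)"
      using that by (rule has_field_derivative_transform_within_open[OF e[OF that] open_ball])
        (simp add: d1)
  qed
  show ?thesis
  proof
    have "f holomorphic_on unit_disk"
      unfolding holomorphic_on_open[OF open_ball] using f by blast
    moreover have "f 0 = 0" "e 0 = 1" "e z \<noteq> 0" for z
      by (simp_all add: f_def e_def)
    ultimately show "f \<in> class_A_reg"
      by (simp add: class_A_reg_def class_A_def d1)
    show "convexity_quotient f z = p z" if "z \<in> unit_disk" for z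
    proof -
      have "convexity_quotient f z = 1 + z * h z"
        using \<open>e z \<noteq> 0\<close> by (simp add: convexity_quotient_def d1[OF that] d2[OF that])
      then show ?thesis
        using p(2) by (simp add: h_def)
    qed
  qed
qed

lemma ex_class_C_extremal:
  assumes \<phi>: "\<phi> holomorphic_on unit_disk" "\<phi> 0 = 1"
  obtains f where "f \<in> class_C \<phi>" "\<And>z. z \<in> unit_disk \<Longrightarrow> convexity_quotient f z = \<phi> z"
proof -
  obtain f where f: "f \<in> class_A_reg" "\<And>z. z \<in> unit_disk \<Longrightarrow> convexity_quotient f z = \<phi> z"
    using ex_convexity_quotient[OF \<phi>] by metis
  have "convexity_quotient f holomorphic_on unit_disk"
    using \<phi>(1) by (rule holomorphic_transform) (simp add: f(2))
  with f(2) \<phi>(1) have "convexity_quotient f \<prec> \<phi>"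
    unfolding subordinate_def by (intro conjI exI[of _ "\<lambda>z. z"] holomorphic_intros) auto
  with f(1) have "f \<in> class_C \<phi>"
    by (simp add: class_C_def)
  then show ?thesis
    using f(2) by (rule that)
qed

text \<open>The common obstruction behind the sharpness of (c)-(f): real values of
  \<open>neph\<close> on the disk stay within 2/3 of 1.\<close>

lemma not_in_class_C_Ne:
  assumes "z \<in> unit_disk" "convexity_quotient f z = of_real t" "\<bar>t - 1\<bar> \<ge> 2 / 3"
  shows "f \<notin> class_C_Ne"
  unfolding class_C_Ne_eq
proof
  assume "f \<in> class_C neph"
  then obtain w where "w \<in> unit_disk" "convexity_quotient f z = neph w"
    using assms(1) by (rule class_C_convexity_quotient_values)
  then show False
    using neph_real_value[of w] assms(2,3) by (metis Im_complex_of_real Re_complex_of_real not_le)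
qed

lemma class_C_not_subset_class_C_Ne:
  assumes "\<phi> holomorphic_on unit_disk" "\<phi> 0 = 1"
    and "z \<in> unit_disk" "\<phi> z = of_real t" "\<bar>t - 1\<bar> \<ge> 2 / 3"
  shows "\<not> class_C \<phi> \<subseteq> class_C_Ne"
proof -
  obtain f where "f \<in> class_C \<phi>" "\<And>z. z \<in> unit_disk \<Longrightarrow> convexity_quotient f z = \<phi> z"
    using ex_class_C_extremal[OF assms(1,2)] by blast
  then show ?thesis
    using not_in_class_C_Ne[of z f t] assms by auto
qed

text \<open>The bounds for (a) and (b) are attained on the unit circle only. With \<open>g\<close>
  measuring a violation, continuity along the radius moves it from a boundary point \<open>z\<close>
  into the disk.\<close>

lemma radial_pos:
  fixes g :: "complex \<Rightarrow> real"
  assumes "isCont g z" "g z > 0"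
  obtains r where "0 < r" "r < 1" "g (of_real r * z) > 0"
proof -
  have "((\<lambda>r. of_real r * z) \<longlongrightarrow> of_real 1 * z) (at_left (1::real))"
    by (intro tendsto_intros)
  then have "((\<lambda>r. g (of_real r * z)) \<longlongrightarrow> g z) (at_left 1)"
    using assms(1) isCont_tendsto_compose[of z g] by simp
  then have "eventually (\<lambda>r. g (of_real r * z) > 0) (at_left 1)"
    using assms(2) by (rule order_tendstoD)
  moreover have "eventually (\<lambda>r::real. r \<in> {0<..<1}) (at_left 1)"
    by (rule eventually_at_leftI[of 0]) auto
  ultimately have "eventually (\<lambda>r. g (of_real r * z) > 0 \<and> r \<in> {0<..<1}) (at_left 1)"
    by (rule eventually_conj)
  then obtain r where "g (of_real r * z) > 0 \<and> r \<in> {0<..<1}"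
    using eventually_happens'[OF trivial_limit_at_left_real] by blast
  then show ?thesis
    by (intro that[of r]) simp_all
qed

subsection \<open>Elementary estimates\<close>

text \<open>With s the root and t = \<open>sqrt (1 - c)\<close>, one has (s - 1)(s + 1) = c z, and
  (Re s)^2 > t^2 gives |s + 1| \<ge> 1 + t. Hence |s - 1| < c / (1 + t) = 1 - t.\<close>

lemma norm_csqrt_minus_1_less:
  assumes "0 < c" "c \<le> 1" "norm z < 1"
  shows "norm (csqrt (1 + of_real c * z) - 1) < 1 - sqrt (1 - c)"
proof -
  define s where "s = csqrt (1 + of_real c * z)"
  define t where "t = sqrt (1 - c)"
  have t: "t\<^sup>2 = 1 - c" "t \<ge> 0"
    using assms by (auto simp: t_def)
  have s2: "s\<^sup>2 = 1 + of_real c * z"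
    by (simp add: s_def)
  have "- Re z < 1"
    using abs_Re_le_cmod[of z] assms by linarith
  then have "- (c * Re z) < c"
    using mult_strict_left_mono[of "- Re z" 1 c] assms by simp
  moreover have "(Re s)\<^sup>2 - (Im s)\<^sup>2 = 1 + c * Re z"
    using arg_cong[OF s2, of Re] by (simp add: power2_eq_square)
  ultimately have "(Re s)\<^sup>2 > t\<^sup>2"
    using t zero_le_power2[of "Im s"] by linarith
  then have "Re s > t"
    by (rule power2_less_imp_less) (simp only: s_def Re_csqrt)
  then have *: "norm (s + 1) \<ge> 1 + t"
    using abs_Re_le_cmod[of "s + 1"] by simp
  have "(s - 1) * (s + 1) = of_real c * z"
    using s2 by (simp add: power2_eq_square algebra_simps)
  then have "norm (s - 1) * norm (s + 1) = c * norm z"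
    using assms by (simp flip: norm_mult) (simp add: norm_mult)
  also have "\<dots> < c"
    using assms by simp
  also have "c = (1 - t) * (1 + t)"
    using t by (simp add: power2_eq_square algebra_simps)
  finally have "norm (s - 1) * norm (s + 1) < (1 - t) * (1 + t)" .
  moreover have "(1 - t) * (1 + t) \<le> norm (s - 1) * norm (s + 1)" if "1 - t \<le> norm (s - 1)"
    using that * t by (intro mult_mono) simp_all
  ultimately have "norm (s - 1) < 1 - t"
    by linarith
  then show ?thesis
    by (simp only: s_def t_def)
qed

lemma holomorphic_on_csqrt_1_plus:
  assumes "0 \<le> c" "c \<le> 1"
  shows "(\<lambda>z. csqrt (1 + of_real c * z)) holomorphic_on unit_disk"
proof (intro holomorphic_intros)
  fix z assume "z \<in> unit_disk"
  then have "\<bar>c * Re z\<bar> < 1"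
    using assms abs_Re_le_cmod[of z] mult_left_le_one_le[of "\<bar>Re z\<bar>" c] by (simp add: abs_mult)
  then show "1 + of_real c * z \<notin> \<real>\<^sub>\<le>\<^sub>0"
    by (auto simp: complex_nonpos_Reals_iff)
qed

text \<open>Compare the two exponential series termwise after removing the constant term.\<close>

lemma norm_exp_minus_1_le:
  fixes z :: complex
  shows "norm (exp z - 1) \<le> exp (norm z) - 1"
proof -
  have sm: "summable (\<lambda>n. inverse (fact (Suc n)) *\<^sub>R norm z ^ Suc n)"
    using summable_exp_generic[of "norm z"] by (subst summable_Suc_iff) (simp add: divide_inverse)
  have nrm: "norm (inverse (fact (Suc n)) *\<^sub>R z ^ Suc n) = inverse (fact (Suc n)) *\<^sub>R norm z ^ Suc n" for n
    by (simp only: norm_scaleR norm_power real_scaleR_def) simp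
  have "norm (exp z - 1) = norm (\<Sum>n. inverse (fact (Suc n)) *\<^sub>R z ^ Suc n)"
    unfolding exp_first_term[of z] by (simp only: add_diff_cancel_left')
  also have "\<dots> \<le> (\<Sum>n. norm (inverse (fact (Suc n)) *\<^sub>R z ^ Suc n))"
    by (rule summable_norm) (use sm in \<open>simp only: nrm\<close>)
  also have "\<dots> = exp (norm z) - 1"
    unfolding nrm exp_first_term[of "norm z"] by (simp only: add_diff_cancel_left')
  finally show ?thesis .
qed

section \<open>The constant \<open>beta0\<close>\<close>

lemma arctan_4_sqrt5: "arctan (4 * sqrt 5) = beta0 * pi / 2"
  by (simp add: beta0_def)

lemma beta0_bounds: "0 < beta0" "beta0 < 1"
  using arctan_ubound[of "4 * sqrt 5"] by (auto simp: beta0_def field_simps)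

text \<open>The reciprocal of \<open>4 * sqrt 5\<close> is the small number
  \<open>sqrt 5 / 20\<close>, whose arctan complements the wanted one to pi / 2. Two consecutive
  partial sums of the arctan series enclose it tightly enough.\<close>

lemma beta0_approx: "\<bar>beta0 - 0.929121\<bar> < 1 / 10 ^ 5"
proof -
  define x where "x = sqrt 5 / 20"
  have s5: "2.236067 < sqrt 5" "sqrt 5 < 2.236068"
    by (rule real_less_rsqrt real_less_lsqrt; simp add: power2_eq_square)+
  have x: "0 \<le> x" "x < 1"
    using s5 by (auto simp: x_def)
  have x2: "x * x = 1 / 80"
    by (simp add: x_def)
  have "x ^ 3 = (x * x) * x" "x ^ 5 = (x * x) * ((x * x) * x)"
    by (simp_all add: eval_nat_numeral)
  then have pow: "x ^ 3 = x / 80" "x ^ 5 = x / 6400"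
    unfolding x2 by simp_all
  have "x - x ^ 3 / 3 \<le> arctan x"
    using arctan_lower_bound[OF x, of 1] by (simp add: eval_nat_numeral)
  moreover have "arctan x \<le> x - x ^ 3 / 3 + x ^ 5 / 5"
    using arctan_upper_bound[OF x, of 1] by (simp add: eval_nat_numeral)
  ultimately have A: "0.111337 < arctan x" "arctan x < 0.111342"
    unfolding pow using s5 by (simp_all add: x_def)
  have "inverse (4 * sqrt 5) = x"
    using s5 by (simp add: x_def field_simps)
  then have "arctan x = pi / 2 - arctan (4 * sqrt 5)"
    using arctan_inverse[of "4 * sqrt 5"] by (simp only:) simp
  then have "arctan (4 * sqrt 5) = pi / 2 - arctan x"
    by simp
  then have "beta0 * pi = pi - 2 * arctan x"
    by (simp add: beta0_def field_simps)
  with A pi_approx have "0.929111 * pi < beta0 * pi" "beta0 * pi < 0.929131 * pi"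
    by simp_all
  then have "0.929111 < beta0" "beta0 < 0.929131"
    by simp_all
  then show ?thesis
    unfolding abs_less_iff by simp
qed

subsection \<open>Inclusions\<close>

lemma class_C_Ne_subset_class_C_order:
  assumes "\<alpha> \<le> 1 - 2 * sqrt 2 / 3"
  shows "class_C_Ne \<subseteq> class_C_order \<alpha>"
proof
  fix f assume f: "f \<in> class_C_Ne"
  have "Re (convexity_quotient f z) > \<alpha>" if z: "z \<in> unit_disk" for z
  proof -
    from f z obtain w where "w \<in> unit_disk" "convexity_quotient f z = neph w"
      unfolding class_C_Ne_eq by (rule class_C_convexity_quotient_values)
    then show ?thesis
      using neph_Re_gt[of w] assms by simp
  qed
  with f show "f \<in> class_C_order \<alpha>"
    by (simp add: class_C_order_def class_C_Ne_def class_C_def)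
qed

text \<open>A positive real part makes the principal argument the arctan of the slope, so the sector
  inequality bounds it by monotonicity.\<close>

lemma Arg_neph:
  assumes "z \<in> unit_disk"
  shows "neph z \<noteq> 0" and "Arg (neph z) = arctan (Im (neph z) / Re (neph z))"
    and "\<bar>Arg (neph z)\<bar> < beta0 * pi / 2"
proof -
  note pos = neph_Re_pos[OF assms]
  show "neph z \<noteq> 0"
    using pos by auto
  show Arg: "Arg (neph z) = arctan (Im (neph z) / Re (neph z))"
    using pos by (rule arg_conv_arctan)
  have "Im (neph z) / Re (neph z) < 4 * sqrt 5" "- (4 * sqrt 5) < Im (neph z) / Re (neph z)"
    using neph_sector[OF assms] pos by (simp_all add: abs_less_iff field_simps)
  then have "Arg (neph z) < arctan (4 * sqrt 5)" "- arctan (4 * sqrt 5) < Arg (neph z)"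
    unfolding Arg arctan_minus[symmetric] arctan_less_iff by simp_all
  then show "\<bar>Arg (neph z)\<bar> < beta0 * pi / 2"
    by (simp add: arctan_4_sqrt5 abs_less_iff)
qed

lemma class_C_Ne_subset_class_SC:
  assumes "beta0 \<le> \<beta>"
  shows "class_C_Ne \<subseteq> class_SC \<beta>"
proof
  fix f assume f: "f \<in> class_C_Ne"
  have le: "beta0 * pi / 2 \<le> \<beta> * pi / 2"
    using assms by simp
  have "convexity_quotient f z \<noteq> 0 \<and> \<bar>Arg (convexity_quotient f z)\<bar> < \<beta> * pi / 2"
    if z: "z \<in> unit_disk" for z
  proof -
    from f z obtain w where "w \<in> unit_disk" "convexity_quotient f z = neph w"
      unfolding class_C_Ne_eq by (rule class_C_convexity_quotient_values)
    then show ?thesis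
      using Arg_neph(1,3)[of w] less_le_trans[OF _ le] by metis
  qed
  with f show "f \<in> class_SC \<beta>"
    by (simp add: class_SC_def class_C_Ne_def class_C_def)
qed

lemma class_C_q_subset_class_C_Ne:
  assumes "0 < c" "c \<le> 8 / 9"
  shows "class_C_q c \<subseteq> class_C_Ne"
  unfolding class_C_q_def
proof (rule class_C_subset_class_C_NeI)
  fix z assume "z \<in> unit_disk"
  then have "norm (csqrt (1 + of_real c * z) - 1) < 1 - sqrt (1 - c)"
    using assms by (intro norm_csqrt_minus_1_less) auto
  \<comment> \<open>Here 8/9 enters: it is the c for which \<open>sqrt (1 - c)\<close> equals
    1/3.\<close>
  moreover have "1 / 3 \<le> sqrt (1 - c)"
    using assms by (intro real_le_rsqrt) (simp add: power2_eq_square)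
  ultimately show "norm (csqrt (1 + of_real c * z) - 1) < 2 / 3"
    by simp
qed

text \<open>If n is the distance of a value from 1, membership in the conic region gives (5/2) n
  \<le> k n < 1 + n, hence n < 2/3.\<close>

lemma class_UCV_subset_class_C_Ne:
  assumes "5 / 2 \<le> k"
  shows "class_UCV k \<subseteq> class_C_Ne"
proof
  fix f assume "f \<in> class_UCV k"
  then have f: "f \<in> class_A_reg" "convexity_quotient f holomorphic_on unit_disk"
    and conic: "\<And>z. z \<in> unit_disk \<Longrightarrow>
      Re (convexity_quotient f z) > k * norm (convexity_quotient f z - 1)"
    by (auto simp: class_UCV_def)
  have "norm (convexity_quotient f z - 1) < 2 / 3" if "z \<in> unit_disk" for z
  proof -
    let ?n = "norm (convexity_quotient f z - 1)"
    have "5 / 2 * ?n \<le> k * ?n"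
      using assms by (intro mult_right_mono) auto
    moreover have "Re (convexity_quotient f z) \<le> 1 + ?n"
      using complex_Re_le_cmod[of "convexity_quotient f z - 1"] by simp
    ultimately show ?thesis
      using conic[OF that] by linarith
  qed
  with f show "f \<in> class_C_Ne"
    using subordinate_nephI[of "convexity_quotient f"] by (simp add: class_C_Ne_eq class_C_def)
qed

lemma class_C_exp_subset_class_C_Ne:
  assumes "1 - (2 / 3) / (exp 1 - 1) \<le> \<alpha>" "\<alpha> < 1"
  shows "class_C_exp \<alpha> \<subseteq> class_C_Ne"
  unfolding class_C_exp_def
proof (rule class_C_subset_class_C_NeI)
  fix z :: complex assume "z \<in> unit_disk"
  then have "exp (norm z) < exp 1"
    by simp
  then have "norm (exp z - 1) < exp 1 - 1"
    using norm_exp_minus_1_le[of z] by linarith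
  then have "(1 - \<alpha>) * norm (exp z - 1) < (1 - \<alpha>) * (exp 1 - 1)"
    using assms by simp
  \<comment> \<open>The threshold for \<open>\<alpha>\<close> is the solution of
    \<open>(1 - \<alpha>) * (exp 1 - 1) = 2 / 3\<close>.\<close>
  also have "\<dots> \<le> 2 / 3"
    using assms exp_gt_one[of "1::real"] by (simp add: field_simps)
  also have "(1 - \<alpha>) * norm (exp z - 1) = norm ((1 - of_real \<alpha>) * (exp z - 1))"
    using assms by (metis abs_of_pos diff_gt_0_iff_gt norm_mult norm_of_real of_real_1 of_real_diff)
  finally show "norm (of_real \<alpha> + (1 - of_real \<alpha>) * exp z - 1) < 2 / 3"
    by (simp add: algebra_simps)
qed

lemma class_CL_subset_class_C_Ne:
  assumes "1 / 3 \<le> \<alpha>" "\<alpha> < 1"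
  shows "class_CL \<alpha> \<subseteq> class_C_Ne"
  unfolding class_CL_def
proof (rule class_C_subset_class_C_NeI)
  fix z :: complex assume "z \<in> unit_disk"
  then have "norm (csqrt (1 + z) - 1) < 1"
    using norm_csqrt_minus_1_less[of 1 z] by simp
  then have "(1 - \<alpha>) * norm (csqrt (1 + z) - 1) < (1 - \<alpha>) * 1"
    using assms by (intro mult_strict_left_mono) auto
  also have "\<dots> \<le> 2 / 3"
    using assms by simp
  also have "(1 - \<alpha>) * norm (csqrt (1 + z) - 1) = norm ((1 - of_real \<alpha>) * (csqrt (1 + z) - 1))"
    using assms by (metis abs_of_pos diff_gt_0_iff_gt norm_mult norm_of_real of_real_1 of_real_diff)
  finally show "norm (of_real \<alpha> + (1 - of_real \<alpha>) * csqrt (1 + z) - 1) < 2 / 3"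
    by (simp add: algebra_simps)
qed

subsection \<open>Sharpness\<close>

lemma ex_class_C_Ne_extremal:
  obtains f where "f \<in> class_C_Ne" "\<And>z. z \<in> unit_disk \<Longrightarrow> convexity_quotient f z = neph z"
  unfolding class_C_Ne_eq
  by (rule ex_class_C_extremal[of neph]) (auto simp: neph_def intro: neph_holomorphic_on)

section \<open>Sharpness of (a) and (b), from boundary points of equality\<close>

lemma class_C_Ne_not_subset_class_C_order:
  assumes "\<alpha> > 1 - 2 * sqrt 2 / 3"
  shows "\<not> class_C_Ne \<subseteq> class_C_order \<alpha>"
proof -
  \<comment> \<open>The real part is the double root in the lower bound for
    \<open>Re (neph z)\<close> on the circle.\<close>
  define \<zeta> where "\<zeta> = Complex (- (sqrt 2 / 2)) (sqrt 2 / 2)"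
  have \<zeta>: "norm \<zeta> = 1"
    by (simp add: \<zeta>_def cmod_def power_divide)
  have "Re (neph \<zeta>) = 1 - 2 * sqrt 2 / 3"
    unfolding neph_on_circle[OF \<zeta>] by (simp add: \<zeta>_def power3_eq_cube)
  then obtain r where r: "0 < r" "r < 1" "\<alpha> - Re (neph (of_real r * \<zeta>)) > 0"
    using radial_pos[of \<zeta> "\<lambda>z. \<alpha> - Re (neph z)"] assms isCont_neph
    by (auto intro!: continuous_intros)
  then have "of_real r * \<zeta> \<in> unit_disk"
    using \<zeta> by (simp add: norm_mult)
  moreover obtain f where "f \<in> class_C_Ne" "\<And>z. z \<in> unit_disk \<Longrightarrow> convexity_quotient f z = neph z"
    using ex_class_C_Ne_extremal by blast
  ultimately show ?thesis
    using r(3) by (force simp: class_C_order_def)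
qed

lemma class_C_Ne_not_subset_class_SC:
  assumes "\<beta> < beta0"
  shows "\<not> class_C_Ne \<subseteq> class_SC \<beta>"
proof -
  \<comment> \<open>The real part is the double root in the sector inequality; the slope of
    \<open>neph \<zeta>\<close> is exactly \<open>4 * sqrt 5\<close>.\<close>
  define \<zeta> where "\<zeta> = Complex (- 2 / 3) (sqrt 5 / 3)"
  have \<zeta>: "norm \<zeta> = 1"
    by (simp add: \<zeta>_def cmod_def power_divide)
  have val: "Re (neph \<zeta>) = 5 / 81" "Im (neph \<zeta>) = 20 * sqrt 5 / 81"
    unfolding neph_on_circle[OF \<zeta>] by (simp_all add: \<zeta>_def power3_eq_cube)
  \<comment> \<open>Inside the disk this arctan is \<open>Arg (neph z)\<close>; in this form
    continuity at \<open>\<zeta>\<close> only needs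
    \<open>Re (neph \<zeta>) \<noteq> 0\<close>.\<close>
  let ?g = "\<lambda>z. arctan (Im (neph z) / Re (neph z)) - \<beta> * pi / 2"
  have "isCont ?g \<zeta>"
    using isCont_neph val by (intro continuous_intros) auto
  moreover have "?g \<zeta> > 0"
    using assms by (simp add: val arctan_4_sqrt5)
  ultimately obtain r where r: "0 < r" "r < 1" "?g (of_real r * \<zeta>) > 0"
    by (rule radial_pos)
  then have z: "of_real r * \<zeta> \<in> unit_disk"
    using \<zeta> by (simp add: norm_mult)
  obtain f where "f \<in> class_C_Ne" "\<And>z. z \<in> unit_disk \<Longrightarrow> convexity_quotient f z = neph z"
    using ex_class_C_Ne_extremal by blast
  moreover from this(2)[OF z] have "Arg (convexity_quotient f (of_real r * \<zeta>)) > \<beta> * pi / 2"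
    using r(3) Arg_neph(2)[OF z] by simp
  ultimately show ?thesis
    using z unfolding class_SC_def by force
qed

section \<open>Sharpness of (c), (f) and (e), from real values\<close>

lemma class_C_q_not_subset_class_C_Ne:
  assumes "8 / 9 < c" "c \<le> 1"
  shows "\<not> class_C_q c \<subseteq> class_C_Ne"
  unfolding class_C_q_def
proof (rule class_C_not_subset_class_C_Ne)
  \<comment> \<open>Chosen so that 1 + c z = 1/9, whose root 1/3 is at distance 2/3 from 1;
    \<open>8 / 9 < c\<close> puts the point in the disk.\<close>
  show "- of_real (8 / (9 * c)) \<in> unit_disk"
    using assms by (simp only: mem_ball_0 norm_minus_cancel norm_of_real) (simp add: field_simps)
  have "1 + of_real c * - of_real (8 / (9 * c)) = (complex_of_real (1 / 3))\<^sup>2"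
    using assms by (simp add: field_simps power2_eq_square)
  then show "csqrt (1 + of_real c * - of_real (8 / (9 * c))) = of_real (1 / 3)"
    using csqrt_square[of "of_real (1 / 3)"] by (simp only:) simp
qed (use assms in \<open>auto intro!: holomorphic_on_csqrt_1_plus\<close>)

lemma class_CL_not_subset_class_C_Ne:
  assumes "0 \<le> \<alpha>" "\<alpha> < 1 / 3"
  shows "\<not> class_CL \<alpha> \<subseteq> class_C_Ne"
  unfolding class_CL_def
proof (rule class_C_not_subset_class_C_Ne)
  \<comment> \<open>Solves \<open>\<alpha> + (1 - \<alpha>) * t = 1 / 3\<close>, and
    \<open>csqrt (1 + z)\<close> equals t at \<open>t\<^sup>2 - 1\<close>. The condition
    \<open>\<alpha> < 1 / 3\<close> makes t positive.\<close>
  define t where "t = 1 - (2 / 3) / (1 - \<alpha>)"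
  have t: "0 < t" "t < 1"
    using assms by (auto simp: t_def field_simps)
  then have "t\<^sup>2 < 1" "t\<^sup>2 > 0"
    by (auto simp: power_less_one_iff)
  then have "\<bar>t\<^sup>2 - 1\<bar> < 1"
    by (simp add: abs_less_iff)
  then show "of_real (t\<^sup>2 - 1) \<in> unit_disk"
    by (simp only: mem_ball_0 norm_of_real)
  have "1 + of_real (t\<^sup>2 - 1) = (complex_of_real t)\<^sup>2"
    by simp
  then have "csqrt (1 + of_real (t\<^sup>2 - 1)) = of_real t"
    using csqrt_square[of "of_real t"] t by (simp only:) simp
  then have "of_real \<alpha> + (1 - of_real \<alpha>) * csqrt (1 + of_real (t\<^sup>2 - 1))
      = of_real (\<alpha> + (1 - \<alpha>) * t)"
    by (simp only: of_real_add of_real_diff of_real_mult of_real_1)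
  also have "\<alpha> + (1 - \<alpha>) * t = 1 / 3"
    using assms by (simp add: t_def field_simps)
  finally show "of_real \<alpha> + (1 - of_real \<alpha>) * csqrt (1 + of_real (t\<^sup>2 - 1)) = of_real (1 / 3)" .
  show "(\<lambda>z. of_real \<alpha> + (1 - of_real \<alpha>) * csqrt (1 + z)) holomorphic_on unit_disk"
    using holomorphic_on_csqrt_1_plus[of 1] by (auto intro!: holomorphic_intros)
qed (use assms in auto)

lemma class_C_exp_not_subset_class_C_Ne:
  assumes "0 \<le> \<alpha>" "\<alpha> < 1 - (2 / 3) / (exp 1 - 1)"
  shows "\<not> class_C_exp \<alpha> \<subseteq> class_C_Ne"
  unfolding class_C_exp_def
proof (rule class_C_not_subset_class_C_Ne)
  have e: "exp 1 > (1::real)"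
    by simp
  then have "(2 / 3) / (exp 1 - 1) > (0::real)"
    by simp
  with assms have "\<alpha> < 1"
    by linarith
  \<comment> \<open>Solves \<open>\<alpha> + (1 - \<alpha>) * exp x = 5 / 3\<close>; the solution is
    below 1 because \<open>\<alpha>\<close> is below its threshold.\<close>
  define x where "x = ln (1 + (2 / 3) / (1 - \<alpha>))"
  have pos: "(2 / 3) / (1 - \<alpha>) > 0"
    using \<open>\<alpha> < 1\<close> by simp
  then have exp_x: "exp x = 1 + (2 / 3) / (1 - \<alpha>)"
    unfolding x_def by (intro exp_ln) linarith
  also have "\<dots> < exp 1"
    using assms e \<open>\<alpha> < 1\<close> by (simp add: field_simps)
  finally have "x < 1"
    by simp
  moreover have "0 < x"
    unfolding x_def using pos by (intro ln_gt_zero) linarith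
  ultimately show "of_real x \<in> unit_disk"
    by simp
  have "\<alpha> + (1 - \<alpha>) * exp x = 5 / 3"
    unfolding exp_x using \<open>\<alpha> < 1\<close> by (simp add: field_simps)
  then have "complex_of_real (\<alpha> + (1 - \<alpha>) * exp x) = of_real (5 / 3)"
    by (simp only:)
  then show "of_real \<alpha> + (1 - of_real \<alpha>) * exp (of_real x) = complex_of_real (5 / 3)"
    by (simp only: of_real_add of_real_diff of_real_mult of_real_1 exp_of_real)
qed (auto intro!: holomorphic_intros)

text \<open>With \<open>k = 1 + 1 / b\<close>, the function \<open>1 + b (1 - b) z / (1 - b z)\<close> maps the disk onto the
  osculating disk at the right vertex \<open>1 + b\<close> of the ellipse bounding the conic region.\<close>

lemma osculating_disk_in_conic_region:
  fixes z :: complex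
  assumes b: "0 < b" "b < 1" and z: "norm z < 1"
  defines "p \<equiv> 1 + of_real (b * (1 - b)) * (z / (1 - of_real b * z))"
  shows "Re p > (1 + 1 / b) * norm (p - 1)"
proof -
  define q where "q = 1 - of_real b * z"
  have "norm (of_real b * z) < 1"
    using b z mult_strict_mono'[of b 1 "norm z" 1] by (simp add: norm_mult)
  then have q: "norm q > 0"
    by (auto simp: q_def)
  have q2: "(norm q)\<^sup>2 = 1 - 2 * b * Re z + b\<^sup>2 * (norm z)\<^sup>2"
    by (simp add: q_def cmod_power2) algebra
  have norm_p: "norm (p - 1) = b * (1 - b) * (norm z / norm q)"
    unfolding p_def q_def[symmetric] add_diff_cancel_left' norm_mult norm_divide norm_of_real
    using b by simp
  have Re_mult: "Re (of_real r * w) = r * Re w" for r w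
    by simp
  have "Re z * Re q + Im z * Im q = Re z - b * (norm z)\<^sup>2"
    by (simp add: q_def cmod_power2) (simp add: power2_eq_square algebra_simps)
  then have "Re (z / q) = (Re z - b * (norm z)\<^sup>2) / (norm q)\<^sup>2"
    unfolding Re_divide' by simp
  then have "Re p = 1 + b * (1 - b) * ((Re z - b * (norm z)\<^sup>2) / (norm q)\<^sup>2)"
    unfolding p_def q_def[symmetric] plus_complex.sel one_complex.sel Re_mult by (simp only:)
  then have "2 * (Re p * (norm q)\<^sup>2) = 2 * (norm q)\<^sup>2 + 2 * (b * (1 - b) * (Re z - b * (norm z)\<^sup>2))"
    using q by (simp add: field_simps)
  also have "\<dots> = (1 - b) * (1 - b\<^sup>2 * (norm z)\<^sup>2) + (1 + b) * (norm q)\<^sup>2"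
    unfolding q2 by algebra
  \<comment> \<open>After \<open>Re z\<close> has been eliminated through \<open>q2\<close>,
    strictness comes from \<open>norm z < 1\<close>.\<close>
  also have "\<dots> > (1 - b) * ((1 - b\<^sup>2) * (norm z)\<^sup>2) + (1 + b) * (norm q)\<^sup>2"
  proof (intro add_strict_right_mono mult_strict_left_mono)
    have "(norm z)\<^sup>2 < 1"
      using z by (simp add: abs_square_less_1)
    then show "(1 - b\<^sup>2) * (norm z)\<^sup>2 < 1 - b\<^sup>2 * (norm z)\<^sup>2"
      by (simp add: algebra_simps)
  qed (use b in simp)
  \<comment> \<open>Completing the square isolates the product of the norms. The square vanishes at
    z = 1, which corresponds to the vertex.\<close>
  also (xtrans) have "(1 - b) * ((1 - b\<^sup>2) * (norm z)\<^sup>2) + (1 + b) * (norm q)\<^sup>2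
      = 2 * ((1 - b\<^sup>2) * norm z * norm q) + (1 + b) * ((1 - b) * norm z - norm q)\<^sup>2"
    by algebra
  also (xtrans) have "\<dots> \<ge> 2 * ((1 - b\<^sup>2) * norm z * norm q)"
    using b by simp
  also (xtrans) have "(1 - b\<^sup>2) * norm z * norm q = (1 + 1 / b) * norm (p - 1) * (norm q)\<^sup>2"
    unfolding norm_p using b q by (simp add: field_simps power2_eq_square)
  finally show ?thesis
    using q by simp
qed

lemma class_UCV_not_subset_class_C_Ne:
  assumes "2 < k" "k < 5 / 2"
  shows "\<not> class_UCV k \<subseteq> class_C_Ne"
proof -
  \<comment> \<open>\<open>1 + b\<close> is the right vertex of the ellipse;
    \<open>k < 5 / 2\<close> puts it beyond 5/3, and \<open>2 < k\<close> gives
    \<open>b < 1\<close>.\<close>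
  define b where "b = 1 / (k - 1)"
  have b: "2 / 3 < b" "b < 1" and k: "k = 1 + 1 / b"
    using assms by (auto simp: b_def field_simps)
  define p where "p = (\<lambda>z::complex. 1 + of_real (b * (1 - b)) * (z / (1 - of_real b * z)))"
  have "1 - of_real b * z \<noteq> 0" if "z \<in> unit_disk" for z :: complex
  proof -
    have "norm (of_real b * z) < 1"
      using b that mult_strict_mono'[of b 1 "norm z" 1] by (simp add: norm_mult)
    then show ?thesis
      by auto
  qed
  then have p: "p holomorphic_on unit_disk" "p 0 = 1"
    unfolding p_def by (auto intro!: holomorphic_intros)
  obtain f where f: "f \<in> class_A_reg" "\<And>z. z \<in> unit_disk \<Longrightarrow> convexity_quotient f z = p z"
    using ex_convexity_quotient[OF p] by blast
  have "convexity_quotient f holomorphic_on unit_disk"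
    using p(1) by (rule holomorphic_transform) (simp add: f(2))
  moreover have "Re (p z) > k * norm (p z - 1)" if "z \<in> unit_disk" for z
    unfolding p_def k using b that by (intro osculating_disk_in_conic_region) auto
  ultimately have "f \<in> class_UCV k"
    using f by (simp add: class_UCV_def)
  \<comment> \<open>Solves \<open>p x = 5 / 3\<close> on the real axis; x < 1 amounts to
    \<open>b * (5 - 3 * b) > 2\<close>, that is, \<open>(3 * b - 2) * (1 - b) > 0\<close>.\<close>
  define x where "x = 2 / (b * (5 - 3 * b))"
  have "(3 * b - 2) * (1 - b) > 0"
    using b by (intro mult_pos_pos) auto
  then have "b * (5 - 3 * b) > 2"
    by (simp add: algebra_simps)
  then have x: "0 < x" "x < 1"
    by (auto simp: x_def)
  then have "b * x < 1"
    using b mult_strict_mono'[of b 1 x 1] by simp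
  have "b * (5 - 3 * b) * x = 2"
    using \<open>b * (5 - 3 * b) > 2\<close> unfolding x_def
    by (metis nonzero_mult_div_cancel_left not_numeral_less_zero times_divide_eq_right)
  then have "b * (1 - b) * x = 2 / 3 * (1 - b * x)"
    by (simp add: algebra_simps)
  then have "b * (1 - b) * (x / (1 - b * x)) = 2 / 3 * (1 - b * x) / (1 - b * x)"
    by (metis times_divide_eq_right)
  also have "\<dots> = 2 / 3"
    using \<open>b * x < 1\<close> by (subst nonzero_mult_div_cancel_right) simp_all
  finally have "b * (1 - b) * (x / (1 - b * x)) = 2 / 3" .
  moreover have "p (of_real x) = of_real (1 + b * (1 - b) * (x / (1 - b * x)))"
    by (simp add: p_def)
  ultimately have "p (of_real x) = of_real (5 / 3)"
    by (simp only:) simp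
  then have "f \<notin> class_C_Ne"
    using x f(2)[of "of_real x"] by (intro not_in_class_C_Ne[of "of_real x" f "5 / 3"]) auto
  with \<open>f \<in> class_UCV k\<close> show ?thesis
    by blast
qed

text \<open>Best possible means that a constant moved past its value admits a parameter, still in
  the range where the classes are defined, for which the inclusion fails. Such a parameter is found
  as a minimum or maximum of the moved constant and an admissible value.\<close>

theorem theorem3p2:
  shows
    "(\<forall>\<alpha>::real. 0 \<le> \<alpha> \<and> \<alpha> \<le> 1 - 2 * sqrt 2 / 3 \<longrightarrow> class_C_Ne \<subseteq> class_C_order \<alpha>)
   \<and> (\<forall>\<beta>::real. beta0 \<le> \<beta> \<and> \<beta> \<le> 1 \<longrightarrow> class_C_Ne \<subseteq> class_SC \<beta>)
   \<and> \<bar>beta0 - 0.929121\<bar> < 1 / 10 ^ 5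
   \<and> (\<forall>c::real. 0 < c \<and> c \<le> 8 / 9 \<longrightarrow> class_C_q c \<subseteq> class_C_Ne)
   \<and> (\<forall>k::real. 5 / 2 \<le> k \<longrightarrow> class_UCV k \<subseteq> class_C_Ne)
   \<and> (\<forall>\<alpha>::real. 1 - (2 / 3) / (exp 1 - 1) \<le> \<alpha> \<and> \<alpha> < 1 \<longrightarrow> class_C_exp \<alpha> \<subseteq> class_C_Ne)
   \<and> (\<forall>\<alpha>::real. 1 / 3 \<le> \<alpha> \<and> \<alpha> < 1 \<longrightarrow> class_CL \<alpha> \<subseteq> class_C_Ne)
   \<and> (\<forall>a::real. a > 1 - 2 * sqrt 2 / 3 \<longrightarrow>
        \<not> (\<forall>\<alpha>. 0 \<le> \<alpha> \<and> \<alpha> < 1 \<and> \<alpha> \<le> a \<longrightarrow> class_C_Ne \<subseteq> class_C_order \<alpha>))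
   \<and> (\<forall>b::real. b < beta0 \<longrightarrow>
        \<not> (\<forall>\<beta>. 0 < \<beta> \<and> b \<le> \<beta> \<and> \<beta> \<le> 1 \<longrightarrow> class_C_Ne \<subseteq> class_SC \<beta>))
   \<and> (\<forall>d::real. d > 8 / 9 \<longrightarrow>
        \<not> (\<forall>c. 0 < c \<and> c \<le> 1 \<and> c \<le> d \<longrightarrow> class_C_q c \<subseteq> class_C_Ne))
   \<and> (\<forall>\<kappa>::real. \<kappa> < 5 / 2 \<longrightarrow>
        \<not> (\<forall>k. 0 \<le> k \<and> \<kappa> \<le> k \<longrightarrow> class_UCV k \<subseteq> class_C_Ne))
   \<and> (\<forall>a::real. a < 1 - (2 / 3) / (exp 1 - 1) \<longrightarrow>
        \<not> (\<forall>\<alpha>. 0 \<le> \<alpha> \<and> a \<le> \<alpha> \<and> \<alpha> < 1 \<longrightarrow> class_C_exp \<alpha> \<subseteq> class_C_Ne))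
   \<and> (\<forall>a::real. a < 1 / 3 \<longrightarrow>
        \<not> (\<forall>\<alpha>. 0 \<le> \<alpha> \<and> a \<le> \<alpha> \<and> \<alpha> < 1 \<longrightarrow> class_CL \<alpha> \<subseteq> class_C_Ne))"
proof (intro conjI allI impI)
  show "class_C_Ne \<subseteq> class_C_order \<alpha>" if "0 \<le> \<alpha> \<and> \<alpha> \<le> 1 - 2 * sqrt 2 / 3" for \<alpha>
    using that by (intro class_C_Ne_subset_class_C_order) simp
  show "class_C_Ne \<subseteq> class_SC \<beta>" if "beta0 \<le> \<beta> \<and> \<beta> \<le> 1" for \<beta>
    using that by (intro class_C_Ne_subset_class_SC) simp
  show "\<bar>beta0 - 0.929121\<bar> < 1 / 10 ^ 5"
    by (rule beta0_approx)
  show "class_C_q c \<subseteq> class_C_Ne" if "0 < c \<and> c \<le> 8 / 9" for c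
    using that by (intro class_C_q_subset_class_C_Ne) simp_all
  show "class_UCV k \<subseteq> class_C_Ne" if "5 / 2 \<le> k" for k
    using that by (rule class_UCV_subset_class_C_Ne)
  show "class_C_exp \<alpha> \<subseteq> class_C_Ne" if "1 - (2 / 3) / (exp 1 - 1) \<le> \<alpha> \<and> \<alpha> < 1" for \<alpha>
    using that by (intro class_C_exp_subset_class_C_Ne) simp_all
  show "class_CL \<alpha> \<subseteq> class_C_Ne" if "1 / 3 \<le> \<alpha> \<and> \<alpha> < 1" for \<alpha>
    using that by (intro class_CL_subset_class_C_Ne) simp_all
next
  fix a :: real
  assume a: "a > 1 - 2 * sqrt 2 / 3"
  \<comment> \<open>This puts 1/2 above the threshold, so \<open>min a (1 / 2)\<close> is above it
    and below 1.\<close>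
  have "2 * sqrt 2 / 3 > 1 / (2 :: real)"
    using real_sqrt_gt_1_iff[of 2] by linarith
  with a have "\<not> class_C_Ne \<subseteq> class_C_order (min a (1 / 2))"
    by (intro class_C_Ne_not_subset_class_C_order) (auto simp: min_def)
  moreover have "0 \<le> min a (1 / 2)"
    using a two_sqrt2_less_3 by (auto simp: min_def)
  ultimately show "\<not> (\<forall>\<alpha>. 0 \<le> \<alpha> \<and> \<alpha> < 1 \<and> \<alpha> \<le> a \<longrightarrow> class_C_Ne \<subseteq> class_C_order \<alpha>)"
    by (auto intro!: exI[of _ "min a (1 / 2)"])
next
  fix b :: real
  assume "b < beta0"
  then have max: "max b (beta0 / 2) < beta0"
    using beta0_bounds by simp
  then have "\<not> class_C_Ne \<subseteq> class_SC (max b (beta0 / 2))"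
    by (rule class_C_Ne_not_subset_class_SC)
  moreover have "0 < max b (beta0 / 2)" "max b (beta0 / 2) \<le> 1"
    using max beta0_bounds by (simp_all add: less_max_iff_disj)
  ultimately show "\<not> (\<forall>\<beta>. 0 < \<beta> \<and> b \<le> \<beta> \<and> \<beta> \<le> 1 \<longrightarrow> class_C_Ne \<subseteq> class_SC \<beta>)"
    by (metis max.cobounded1)
next
  fix d :: real
  assume d: "d > 8 / 9"
  then have "\<not> class_C_q (min d 1) \<subseteq> class_C_Ne"
    by (intro class_C_q_not_subset_class_C_Ne) auto
  moreover have "0 < min d 1"
    using d by simp
  ultimately show "\<not> (\<forall>c. 0 < c \<and> c \<le> 1 \<and> c \<le> d \<longrightarrow> class_C_q c \<subseteq> class_C_Ne)"
    by (metis min.cobounded1 min.cobounded2)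
next
  fix \<kappa> :: real
  assume "\<kappa> < 5 / 2"
  \<comment> \<open>The value 9/4 lies between 2 and 5/2, where the osculating-disk example
    applies.\<close>
  then have "\<not> class_UCV (max \<kappa> (9 / 4)) \<subseteq> class_C_Ne"
    by (intro class_UCV_not_subset_class_C_Ne) (auto simp: max_def)
  moreover have "0 \<le> max \<kappa> (9 / 4)"
    by simp
  ultimately show "\<not> (\<forall>k. 0 \<le> k \<and> \<kappa> \<le> k \<longrightarrow> class_UCV k \<subseteq> class_C_Ne)"
    by (metis max.cobounded1)
next
  fix a :: real
  assume a: "a < 1 - (2 / 3) / (exp 1 - 1)"
  \<comment> \<open>Since e \<ge> 2, the threshold is positive, so 0 lies below it and can replace a
    negative \<open>a\<close>.\<close>
  have "exp 1 \<ge> (2 :: real)"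
    using exp_ge_add_one_self[of "1 :: real"] by simp
  then have "(2 / 3) / (exp 1 - 1) < (1 :: real)" "(2 / 3) / (exp 1 - 1) > (0 :: real)"
    by (simp_all add: field_simps)
  with a have "max a 0 < 1 - (2 / 3) / (exp 1 - 1)" "max a 0 < 1"
    by linarith+
  moreover from this(1) have "\<not> class_C_exp (max a 0) \<subseteq> class_C_Ne"
    by (intro class_C_exp_not_subset_class_C_Ne) simp
  ultimately show "\<not> (\<forall>\<alpha>. 0 \<le> \<alpha> \<and> a \<le> \<alpha> \<and> \<alpha> < 1 \<longrightarrow> class_C_exp \<alpha> \<subseteq> class_C_Ne)"
    by (metis max.cobounded1 max.cobounded2)
next
  fix a :: real
  assume a: "a < 1 / 3"
  then have "\<not> class_CL (max a 0) \<subseteq> class_C_Ne"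
    by (intro class_CL_not_subset_class_C_Ne) simp_all
  moreover have "max a 0 < 1"
    using a by simp
  ultimately show "\<not> (\<forall>\<alpha>. 0 \<le> \<alpha> \<and> a \<le> \<alpha> \<and> \<alpha> < 1 \<longrightarrow> class_CL \<alpha> \<subseteq> class_C_Ne)"
    by (metis max.cobounded1 max.cobounded2)
qed

end
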